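(* Let $n\ge 0$ and let $A=(A_{ij})_{1\le i,j\le 2n}$ be a generic skew-symmetric matrix of size $2n$ (the entries $A_{ij}$ with $i<j$ are independent indeterminates, and $\lambda$ is a further indeterminate). Let $\operatorname{Pf}_\lambda(A)$ be the $\lambda$-Pfaffian defined recursively by $$\operatorname{Pf}_\lambda(())=1,\qquad \operatorname{Pf}_\lambda\begin{pmatrix}0&a\\-a&0\end{pmatrix}=a,$$ and, for size $2n$ with $n\ge 2$, $$\operatorname{Pf}_\lambda(A^{(1,2,2n-1,2n)})\operatorname{Pf}_\lambda(A)=\operatorname{Pf}_\lambda(A^{(1,2)})\operatorname{Pf}_\lambda(A^{(2n-1,2n)})-\lambda\operatorname{Pf}_\lambda(A^{(1,2n-1)})\operatorname{Pf}_\lambda(A^{(2,2n)})+\lambda\operatorname{Pf}_\lambda(A^{(1,2n)})\operatorname{Pf}_\lambda(A^{(2,2n-1)}).$$ Then $$\operatorname{Pf}_\lambda(A)=\sum_{m\in\mathcal M([2n])}(-1)^{\mathrm{cross}(m)}\,\lambda^{\mathrm{cross}(m)+\mathrm{nest}(m)}\prod_{i=1}^n A_{m_{2i-1}m_{2i}}.$$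
   Context: $A^{(i_1,\dots,i_r)}$ denotes the matrix obtained from $A$ by deleting the rows and the columns with indices $i_1,\dots,i_r$ (the remaining rows and columns are then relabelled in increasing order, so that the recurrence can be applied to them). $()$ is the empty ($0\times 0$) matrix. The recurrence is read in the field of rational functions in $\lambda$ and the $A_{ij}$, $i<j$: it determines $\operatorname{Pf}_\lambda(A)$ by dividing by $\operatorname{Pf}_\lambda(A^{(1,2,2n-1,2n)})$, a nonzero element of this field. $[2n]=\{1,\dots,2n\}$ and $\mathcal M([2n])$ is the set of perfect matchings of $[2n]$. A perfect matching is written $m=((m_1,m_2),\dots,(m_{2n-1},m_{2n}))$ with $\{m_1,\dots,m_{2n}\}=[2n]$, $m_{2i-1}<m_{2i}$ for all $i$, and $m_1<m_3<\cdots<m_{2n-1}$. $\mathrm{cross}(m)$ is the number of (unordered) pairs of pairs $(a,b),(c,d)$ in $m$ with $a<c<b<d$; $\mathrm{nest}(m)$ is the number of pairs of pairs $(a,b),(c,d)$ in $m$ with $a<c<d<b$. *)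

theory Defs
  imports
    "HOL-Library.Poly_Mapping"
    "HOL-Library.Nat_Bijection"
    "HOL-Computational_Algebra.Fraction_Field"
    "Jordan_Normal_Form.DL_Submatrix"
begin

text \<open>
  The indeterminates are \<open>\<lambda>\<close> and the \<open>A\<^sub>i\<^sub>j\<close>. The (arbitrary) linear order below only
  serves to obtain the library's \<open>idom\<close> instance for polynomials.
\<close>

datatype indet = Lambda | Entry nat nat

fun indet_code :: "indet \<Rightarrow> nat" where
  "indet_code Lambda = 0"
| "indet_code (Entry i j) = Suc (prod_encode (i, j))"

lemma indet_code_eq_iff: "indet_code x = indet_code y \<longleftrightarrow> x = y"
  by (cases x; cases y) (auto simp: prod_encode_eq)

instantiation indet :: linorder
begin

definition less_eq_indet :: "indet \<Rightarrow> indet \<Rightarrow> bool" where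
  "x \<le> y \<longleftrightarrow> indet_code x \<le> indet_code y"

definition less_indet :: "indet \<Rightarrow> indet \<Rightarrow> bool" where
  "x < y \<longleftrightarrow> indet_code x < indet_code y"

instance
  by standard (auto simp: less_eq_indet_def less_indet_def indet_code_eq_iff[symmetric])

end

text \<open>
  Rational functions: fractions of polynomials, where a polynomial is a finitely supported map
  from monomials (exponent functions of type \<open>indet \<Rightarrow>\<^sub>0 nat\<close>) to coefficients. One field contains
  the indeterminates for all sizes at once; a matrix of size \<open>2n\<close> only involves \<open>\<lambda>\<close> and the
  \<open>A\<^sub>i\<^sub>j\<close> with \<open>1 \<le> i < j \<le> 2n\<close>.
\<close>

type_synonym 'a ratfun = "((indet \<Rightarrow>\<^sub>0 nat) \<Rightarrow>\<^sub>0 'a) fract"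

definition var :: "indet \<Rightarrow> 'a::field ratfun" where
  "var x = Fraction_Field.Fract (Poly_Mapping.single (Poly_Mapping.single x 1) 1) 1"

text \<open>
  Matrices of the library are indexed from 0. The next two operations translate to indices
  starting from 1.
\<close>

definition entry :: "'a mat \<Rightarrow> nat \<Rightarrow> nat \<Rightarrow> 'a" where
  "entry A i j = A $$ (i - 1, j - 1)"

definition del :: "'a mat \<Rightarrow> nat set \<Rightarrow> 'a mat" where
  "del A I = submatrix A {k. Suc k \<notin> I} {k. Suc k \<notin> I}"

definition generic_skew :: "nat \<Rightarrow> 'a::field ratfun mat" where
  "generic_skew N = mat N N (\<lambda>(i, j).
     if i < j then var (Entry (Suc i) (Suc j))
     else if j < i then - var (Entry (Suc j) (Suc i))
     else 0)"

text \<open>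
  \<open>lambda_pf l n A\<close> is the \<open>l\<close>-Pfaffian of a matrix \<open>A\<close> of size \<open>2n\<close>. It is meant for matrices
  for which the divisor in the recurrence is nonzero, such as the generic skew-symmetric matrix.
\<close>

fun lambda_pf :: "'a::field \<Rightarrow> nat \<Rightarrow> 'a mat \<Rightarrow> 'a" where
  "lambda_pf l 0 A = 1"
| "lambda_pf l (Suc 0) A = entry A 1 2"
| "lambda_pf l (Suc (Suc k)) A = (let n = k + 2 in
     (lambda_pf l (Suc k) (del A {1, 2}) * lambda_pf l (Suc k) (del A {2*n - 1, 2*n})
      - l * lambda_pf l (Suc k) (del A {1, 2*n - 1}) * lambda_pf l (Suc k) (del A {2, 2*n})
      + l * lambda_pf l (Suc k) (del A {1, 2*n}) * lambda_pf l (Suc k) (del A {2, 2*n - 1}))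
     / lambda_pf l k (del A {1, 2, 2*n - 1, 2*n}))"

definition perfect_matchings :: "nat set \<Rightarrow> (nat \<times> nat) set set" where
  "perfect_matchings V =
     {m. m \<subseteq> {(a, b). a \<in> V \<and> b \<in> V \<and> a < b} \<and> (\<forall>v\<in>V. \<exists>!p\<in>m. v = fst p \<or> v = snd p)}"

text \<open>
  An unordered pair of crossing or nested pairs is counted once, since \<open>a < c\<close> fixes the order.
\<close>

definition cross :: "(nat \<times> nat) set \<Rightarrow> nat" where
  "cross m = card {((a, b), (c, d)) | a b c d.
     (a, b) \<in> m \<and> (c, d) \<in> m \<and> a < c \<and> c < b \<and> b < d}"

definition nest :: "(nat \<times> nat) set \<Rightarrow> nat" where
  "nest m = card {((a, b), (c, d)) | a b c d.
     (a, b) \<in> m \<and> (c, d) \<in> m \<and> a < c \<and> c < d \<and> d < b}"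

end

(*
  Each crossing or nested pair of edges is counted twice in the sum of b - a - 1 over the edges
  (a, b) of a matching m of {1..2n}. Hence cross(m) + nest(m) is the sum of the right endpoints
  minus n(n+1), and the claimed sum equals l^(-n(n+1)) times the ordinary Pfaffian of the weights
  l^j A_ij (i < j). Deleting two of the first and last two indices shifts the right endpoints in
  a controlled way, and the factors l of the recurrence are exactly what turns it into the
  Pluecker relation for ordinary Pfaffians. That relation follows by expanding the double sum
  over i in U and j in V of (sign) B_ij Pf(U - i) Pf(V - j) along either index, for
  U = {1,3,...,2n-2} and V = {2,...,2n}.
*)
theory Submission
  imports Defs "HOL-Computational_Algebra.Polynomial_Factorial"
begin

section \<open>Perfect matchings\<close>

text \<open>Neither \<open>cross\<close> nor \<open>nest\<close> alone is a sum of contributions of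
  single edges, but their sum is, up to a constant depending only on the size. This is why the
  powers of lambda can be absorbed into the matrix entries and an identity for ordinary Pfaffians
  suffices. Two obstacles shape the rest. The Pluecker relation deletes vertices and keeps the
  labels of the others, while the recurrence relabels them from 1. The weight \<open>l ^ j\<close>
  sees this difference, and comparing both readings produces the coefficients of the recurrence.
  Moreover, the recurrence defines its value by a division, so an identity between the sums proves
  the theorem only once the divisors are known to be nonzero. This must hold for every submatrix
  reached by repeated deletion, hence the non-vanishing statement for arbitrary increasing
  relabellings.\<close>

lemma finite_perfect_matching:
  "m \<in> perfect_matchings V \<Longrightarrow> finite V \<Longrightarrow> finite m"
  unfolding perfect_matchings_def
  by (auto intro: finite_subset[of m "V \<times> V"])

lemma finite_perfect_matchings:
  assumes "finite V" shows "finite (perfect_matchings V)"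
  by (rule finite_subset[of _ "Pow (V \<times> V)"]) (use assms in \<open>auto simp: perfect_matchings_def\<close>)

lemma perfect_matchings_memD:
  assumes "m \<in> perfect_matchings V" "(a, b) \<in> m"
  shows "a \<in> V" "b \<in> V" "a < b"
  using assms by (auto simp: perfect_matchings_def)

lemma perfect_matchings_unique:
  assumes "m \<in> perfect_matchings V" "p \<in> m" "q \<in> m"
    and "v = fst p \<or> v = snd p" "v = fst q \<or> v = snd q"
  shows "p = q"
proof -
  have "v \<in> V" using assms by (auto simp: perfect_matchings_def)
  thus ?thesis using assms unfolding perfect_matchings_def by blast
qed

lemma perfect_matchings_ex:
  assumes "m \<in> perfect_matchings V" "v \<in> V"
  obtains p where "p \<in> m" "v = fst p \<or> v = snd p"
  using assms unfolding perfect_matchings_def by blast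

lemma perfect_matchingsI:
  assumes "\<And>a b. (a, b) \<in> m \<Longrightarrow> a \<in> V \<and> b \<in> V \<and> a < b"
    and "\<And>v. v \<in> V \<Longrightarrow> \<exists>p\<in>m. v = fst p \<or> v = snd p"
    and "\<And>v p q. p \<in> m \<Longrightarrow> q \<in> m \<Longrightarrow> v = fst p \<or> v = snd p \<Longrightarrow> v = fst q \<or> v = snd q \<Longrightarrow> p = q"
  shows "m \<in> perfect_matchings V"
proof -
  have "\<exists>!p\<in>m. v = fst p \<or> v = snd p" if "v \<in> V" for v
    using assms(2)[OF that] assms(3)[of _ _ v] by blast
  thus ?thesis unfolding perfect_matchings_def using assms(1) by auto
qed

text \<open>The edges partition \<open>V\<close> into pairs. This is the double counting device of
  the proof: \<open>h\<close> will be constant, the identity, the indicator of an interval, or a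
  weight at the last vertex.\<close>

lemma sum_perfect_matching:
  fixes h :: "nat \<Rightarrow> 'a::comm_monoid_add"
  assumes "m \<in> perfect_matchings V" "finite V"
  shows "(\<Sum>v\<in>V. h v) = (\<Sum>(a, b)\<in>m. h a + h b)"
proof -
  have "V = (\<Union>p\<in>m. {fst p, snd p})"
  proof (intro equalityI subsetI)
    fix v assume "v \<in> V"
    thus "v \<in> (\<Union>p\<in>m. {fst p, snd p})" using perfect_matchings_ex[OF assms(1)] by blast
  next
    fix v assume "v \<in> (\<Union>p\<in>m. {fst p, snd p})"
    thus "v \<in> V" using perfect_matchings_memD(1,2)[OF assms(1)] by auto
  qed
  also have "sum h \<dots> = (\<Sum>p\<in>m. sum h {fst p, snd p})"
  proof (rule sum.UNION_disjoint)
    show "\<forall>p\<in>m. \<forall>q\<in>m. p \<noteq> q \<longrightarrow> {fst p, snd p} \<inter> {fst q, snd q} = {}"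
      using perfect_matchings_unique[OF assms(1)] by blast
  qed (simp_all add: finite_perfect_matching[OF assms])
  also have "\<dots> = (\<Sum>(a, b)\<in>m. h a + h b)"
  proof (rule sum.cong[OF refl], clarify)
    fix a b assume "(a, b) \<in> m"
    thus "sum h {fst (a, b), snd (a, b)} = h a + h b"
      using perfect_matchings_memD(3)[OF assms(1), of a b] by simp
  qed
  finally show ?thesis .
qed

section \<open>Crossings and nestings counted edge by edge\<close>

definition crossing :: "nat \<times> nat \<Rightarrow> nat \<times> nat \<Rightarrow> bool" where
  "crossing p q \<longleftrightarrow> fst p < fst q \<and> fst q < snd p \<and> snd p < snd q"

definition nesting :: "nat \<times> nat \<Rightarrow> nat \<times> nat \<Rightarrow> bool" where
  "nesting p q \<longleftrightarrow> fst p < fst q \<and> fst q < snd q \<and> snd q < snd p"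

lemma cross_eq_sum: "finite m \<Longrightarrow> cross m = (\<Sum>p\<in>m. \<Sum>q\<in>m. of_bool (crossing p q))"
proof -
  assume "finite m"
  have "cross m = card {x \<in> m \<times> m. crossing (fst x) (snd x)}"
    unfolding cross_def crossing_def by (rule arg_cong[where f = card]) auto
  also have "\<dots> = (\<Sum>x\<in>m \<times> m. of_bool (crossing (fst x) (snd x)))"
    using \<open>finite m\<close> by (simp add: sum.If_cases of_bool_def Int_def)
  finally show ?thesis by (simp add: sum.cartesian_product case_prod_unfold)
qed

lemma nest_eq_sum: "finite m \<Longrightarrow> nest m = (\<Sum>p\<in>m. \<Sum>q\<in>m. of_bool (nesting p q))"
proof -
  assume "finite m"
  have "nest m = card {x \<in> m \<times> m. nesting (fst x) (snd x)}"
    unfolding nest_def nesting_def by (rule arg_cong[where f = card]) auto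
  also have "\<dots> = (\<Sum>x\<in>m \<times> m. of_bool (nesting (fst x) (snd x)))"
    using \<open>finite m\<close> by (simp add: sum.If_cases of_bool_def Int_def)
  finally show ?thesis by (simp add: sum.cartesian_product case_prod_unfold)
qed

lemma cross_insert:
  assumes "finite m" "p \<notin> m"
  shows "cross (insert p m) = cross m + (\<Sum>q\<in>m. of_bool (crossing p q) + of_bool (crossing q p))"
proof -
  have [simp]: "\<not> crossing p p" by (simp add: crossing_def)
  show ?thesis
    using assms by (simp add: cross_eq_sum sum.distrib del: sum_of_bool_eq)
qed

text \<open>An edge has one endpoint strictly between \<open>a\<close> and \<open>b\<close> if it
  crosses \<open>(a, b)\<close>, two if it is nested inside, and none otherwise. The edge itself
  gives 0 on both sides, so sums may run over a whole matching containing it.\<close>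

lemma of_bool_between_edges:
  assumes "a < b" "c < d" "(a, b) = (c, d) \<or> {a, b} \<inter> {c, d} = {}"
  shows "of_bool (a < c \<and> c < b) + of_bool (a < d \<and> d < b) =
    of_bool (crossing (a, b) (c, d)) + of_bool (crossing (c, d) (a, b)) + 2 * (of_bool (nesting (a, b) (c, d)) :: nat)"
  using assms by (auto simp: crossing_def nesting_def)

text \<open>The alternative in the hypotheses covers both uses: an edge of \<open>m\<close> itself,
  for counting crossings and nestings, and a new edge outside \<open>W\<close>, for the sign in the
  expansion of a Pfaffian.\<close>

lemma card_between:
  assumes "m \<in> perfect_matchings W" "finite W" "a < b" "(a, b) \<in> m \<or> a \<notin> W \<and> b \<notin> W"
  shows "card {v \<in> W. a < v \<and> v < b} =
    (\<Sum>q\<in>m. of_bool (crossing (a, b) q) + of_bool (crossing q (a, b)) + 2 * of_bool (nesting (a, b) q))"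
proof -
  have "card {v \<in> W. a < v \<and> v < b} = (\<Sum>v\<in>W. of_bool (a < v \<and> v < b))"
    using \<open>finite W\<close> by (simp add: sum.If_cases of_bool_def Int_def)
  also have "\<dots> = (\<Sum>(c, d)\<in>m. of_bool (a < c \<and> c < b) + of_bool (a < d \<and> d < b))"
    by (rule sum_perfect_matching[OF assms(1,2)])
  also have "\<dots> = (\<Sum>q\<in>m. of_bool (crossing (a, b) q) + of_bool (crossing q (a, b)) + 2 * of_bool (nesting (a, b) q))"
  proof (rule sum.cong[OF refl], clarify)
    fix c d assume cd: "(c, d) \<in> m"
    have *: "c \<in> W" "d \<in> W" "c < d" using perfect_matchings_memD[OF assms(1) cd] by auto
    have "(a, b) = (c, d) \<or> {a, b} \<inter> {c, d} = {}"
    proof (cases "(a, b) \<in> m")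
      case True
      have "(a, b) = (c, d)" if "v \<in> {a, b} \<inter> {c, d}" for v
        using that by (intro perfect_matchings_unique[OF assms(1) True cd, of v]) auto
      thus ?thesis by blast
    qed (use assms(4) * in auto)
    thus "of_bool (a < c \<and> c < b) + of_bool (a < d \<and> d < b) =
      of_bool (crossing (a, b) (c, d)) + of_bool (crossing (c, d) (a, b)) + 2 * (of_bool (nesting (a, b) (c, d)) :: nat)"
      by (intro of_bool_between_edges assms *)
  qed
  finally show ?thesis .
qed

lemma card_perfect_matching:
  assumes "m \<in> perfect_matchings V" "finite V"
  shows "card V = 2 * card m"
  using sum_perfect_matching[OF assms, of "\<lambda>_. 1 :: nat"] by (simp add: case_prod_unfold)

text \<open>All endpoints together sum to \<open>k * (2 * k + 1)\<close>, and the differences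
  \<open>b - a - 1\<close> sum to \<open>2 * (cross m + nest m)\<close>. Adding the two gives twice
  the sum of the right endpoints, up to the \<open>k\<close> ones subtracted.\<close>

lemma sum_right_endpoints:
  assumes m: "m \<in> perfect_matchings {1..2 * k}"
  shows "(\<Sum>(a, b)\<in>m. b) = cross m + nest m + k * (k + 1)"
proof -
  have fin: "finite m" using finite_perfect_matching[OF m] by simp
  have card: "card m = k" using card_perfect_matching[OF m] by simp
  have "(\<Sum>v\<in>{1..2 * k}. v) = (\<Sum>(a, b)\<in>m. a + b)" by (rule sum_perfect_matching[OF m]) simp
  hence endpoints: "(\<Sum>(a, b)\<in>m. a) + (\<Sum>(a, b)\<in>m. b) = k * (2 * k + 1)"
    using Sum_Icc_nat[of 1 "2 * k"] by (simp add: sum.distrib case_prod_unfold)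
  have "(\<Sum>(a, b)\<in>m. b) = (\<Sum>(a, b)\<in>m. a + 1 + card {v \<in> {1..2 * k}. a < v \<and> v < b})"
  proof (rule sum.cong[OF refl], clarify)
    fix a b assume ab: "(a, b) \<in> m"
    \<comment> \<open>Here it matters that the vertex set is an interval: every integer between
      \<open>a\<close> and \<open>b\<close> is a vertex.\<close>
    hence "{v \<in> {1..2 * k}. a < v \<and> v < b} = {a<..<b}"
      using perfect_matchings_memD[OF m ab] by auto
    thus "b = a + 1 + card {v \<in> {1..2 * k}. a < v \<and> v < b}"
      using perfect_matchings_memD[OF m ab] by simp
  qed
  also have "\<dots> = (\<Sum>p\<in>m. fst p + 1 +
      (\<Sum>q\<in>m. of_bool (crossing p q) + of_bool (crossing q p) + 2 * of_bool (nesting p q)))"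
  proof (rule sum.cong[OF refl], clarify)
    fix a b assume ab: "(a, b) \<in> m"
    show "a + 1 + card {v \<in> {1..2 * k}. a < v \<and> v < b} = fst (a, b) + 1 + (\<Sum>q\<in>m.
        of_bool (crossing (a, b) q) + of_bool (crossing q (a, b)) + 2 * of_bool (nesting (a, b) q))"
      by (subst card_between[OF m]) (use ab perfect_matchings_memD[OF m ab] in auto)
  qed
  also have "\<dots> = (\<Sum>(a, b)\<in>m. a) + k + (cross m + (\<Sum>p\<in>m. \<Sum>q\<in>m. of_bool (crossing q p)) + 2 * nest m)"
    by (simp add: sum.distrib sum_Suc card case_prod_unfold cross_eq_sum[OF fin] nest_eq_sum[OF fin] sum_distrib_left
        del: sum_of_bool_eq)
  also have "(\<Sum>p\<in>m. \<Sum>q\<in>m. of_bool (crossing q p)) = cross m"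
    unfolding cross_eq_sum[OF fin] by (rule sum.swap)
  finally show ?thesis using endpoints by (simp add: algebra_simps)
qed

section \<open>Adding and removing an edge\<close>

definition edge :: "nat \<Rightarrow> nat \<Rightarrow> nat \<times> nat" where
  "edge i j = (min i j, max i j)"

lemma insert_edge_perfect_matching:
  assumes m: "m \<in> perfect_matchings (V - {i, j})" and ij: "i \<in> V" "j \<in> V" "i \<noteq> j"
  shows "insert (edge i j) m \<in> perfect_matchings V"
proof (rule perfect_matchingsI)
  fix v assume v: "v \<in> V"
  show "\<exists>p\<in>insert (edge i j) m. v = fst p \<or> v = snd p"
    using v perfect_matchings_ex[OF m, of v] by (cases "v \<in> {i, j}") (auto simp: edge_def)
next
  fix v p q
  assume "p \<in> insert (edge i j) m" "q \<in> insert (edge i j) m"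
    and "v = fst p \<or> v = snd p" "v = fst q \<or> v = snd q"
  moreover have "v \<notin> {i, j}" if "p \<in> m" "v = fst p \<or> v = snd p" for p
    using that perfect_matchings_memD(1,2)[OF m, of "fst p" "snd p"] by auto
  moreover have "v \<in> {i, j}" if "v = fst (edge i j) \<or> v = snd (edge i j)"
    using that by (auto simp: edge_def min_def max_def split: if_splits)
  ultimately show "p = q"
    using perfect_matchings_unique[OF m] by blast
next
  fix a b assume "(a, b) \<in> insert (edge i j) m"
  thus "a \<in> V \<and> b \<in> V \<and> a < b"
    using perfect_matchings_memD[OF m] ij by (auto simp: edge_def min_def max_def split: if_splits)
qed

lemma remove_edge_perfect_matching:
  assumes m: "m \<in> perfect_matchings V" and e: "edge i j \<in> m"
  shows "m - {edge i j} \<in> perfect_matchings (V - {i, j})"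
proof (rule perfect_matchingsI)
  fix v assume v: "v \<in> V - {i, j}"
  then obtain p where p: "p \<in> m" "v = fst p \<or> v = snd p"
    using perfect_matchings_ex[OF m, of v] by blast
  have "p \<noteq> edge i j" using p(2) v by (auto simp: edge_def min_def max_def)
  thus "\<exists>p\<in>m - {edge i j}. v = fst p \<or> v = snd p" using p by blast
next
  fix v p q
  assume "p \<in> m - {edge i j}" "q \<in> m - {edge i j}"
    and "v = fst p \<or> v = snd p" "v = fst q \<or> v = snd q"
  thus "p = q" using perfect_matchings_unique[OF m, of p q v] by blast
next
  fix a b assume ab: "(a, b) \<in> m - {edge i j}"
  have "v \<notin> {i, j}" if "v = a \<or> v = b" for v
  proof
    assume "v \<in> {i, j}"
    hence "v = fst (edge i j) \<or> v = snd (edge i j)" by (auto simp: edge_def min_def max_def)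
    thus False using perfect_matchings_unique[OF m _ e, of "(a, b)" v] ab that by auto
  qed
  thus "a \<in> V - {i, j} \<and> b \<in> V - {i, j} \<and> a < b"
    using perfect_matchings_memD[OF m, of a b] ab by auto
qed

text \<open>A matching of \<open>V\<close> has exactly one edge at \<open>i\<close>; sorting the
  matchings by the partner \<open>j\<close> is the combinatorial form of expansion along row
  \<open>i\<close>. The partner may lie on either side of \<open>i\<close>, hence
  \<open>edge\<close>.\<close>

lemma bij_betw_insert_edge:
  assumes "i \<in> V"
  shows "bij_betw (\<lambda>(j, m). insert (edge i j) m)
    (SIGMA j:V - {i}. perfect_matchings (V - {i, j})) (perfect_matchings V)"
proof -
  \<comment> \<open>The vertex \<open>i\<close> is missing below \<open>m\<close> whatever the
    second removed vertex is. Two different partners are allowed because injectivity compares the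
    new edge of one preimage with the old edges of the other.\<close>
  have notin: "edge i j \<notin> m" if "m \<in> perfect_matchings (V - {i, j'})" for j j' m
    using that perfect_matchings_memD(1,2)[OF that, of "fst (edge i j)" "snd (edge i j)"]
    by (auto simp: edge_def min_def max_def split: if_splits)
  show ?thesis
    unfolding bij_betw_def
  proof
    show "inj_on (\<lambda>(j, m). insert (edge i j) m) (SIGMA j:V - {i}. perfect_matchings (V - {i, j}))"
    proof (rule inj_onI, unfold split_paired_all prod.case prod.inject mem_Sigma_iff, elim conjE)
      fix j j' m m'
      assume m: "m \<in> perfect_matchings (V - {i, j})" "m' \<in> perfect_matchings (V - {i, j'})"
        and eq: "insert (edge i j) m = insert (edge i j') m'"
      have "edge i j = edge i j'" using eq notin[OF m(2), of j] by auto
      hence "j = j'" by (auto simp: edge_def min_def max_def split: if_splits)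
      moreover from this eq have "m = m'" using notin[OF m(1), of j] notin[OF m(2), of j']
        by (metis insert_ident)
      ultimately show "j = j' \<and> m = m'" by simp
    qed
    show "(\<lambda>(j, m). insert (edge i j) m) ` (SIGMA j:V - {i}. perfect_matchings (V - {i, j})) = perfect_matchings V"
    proof (intro equalityI subsetI)
      fix m assume m: "m \<in> perfect_matchings V"
      obtain p where p: "p \<in> m" "i = fst p \<or> i = snd p" using perfect_matchings_ex[OF m assms] .
      define j where "j = (if i = fst p then snd p else fst p)"
      have lt: "fst p \<in> V" "snd p \<in> V" "fst p < snd p"
        using perfect_matchings_memD[OF m, of "fst p" "snd p"] p by auto
      have j: "j \<in> V - {i}" "p = edge i j"
        using p lt by (auto simp: j_def edge_def prod_eq_iff)
      have "(j, m - {edge i j}) \<in> (SIGMA j:V - {i}. perfect_matchings (V - {i, j}))"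
        using remove_edge_perfect_matching[OF m, of i j] p(1) j by simp
      moreover have "m = (\<lambda>(j, m). insert (edge i j) m) (j, m - {edge i j})"
        using p(1) j(2) by (simp add: insert_absorb)
      ultimately show "m \<in> (\<lambda>(j, m). insert (edge i j) m) ` (SIGMA j:V - {i}. perfect_matchings (V - {i, j}))"
        by (rule rev_image_eqI)
    next
      fix m assume "m \<in> (\<lambda>(j, m). insert (edge i j) m) ` (SIGMA j:V - {i}. perfect_matchings (V - {i, j}))"
      then obtain j m' where "m = insert (edge i j) m'" "j \<in> V" "j \<noteq> i" "m' \<in> perfect_matchings (V - {i, j})"
        by force
      thus "m \<in> perfect_matchings V" using assms insert_edge_perfect_matching by metis
    qed
  qed
qed

section \<open>Pfaffians and the Pluecker relation\<close>

text \<open>The ordinary Pfaffian of the principal submatrix on \<open>V\<close>, with the sign of a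
  matching written as the parity of its crossings. Only values of \<open>w\<close> above the
  diagonal enter.\<close>

definition pfaffian :: "(nat \<Rightarrow> nat \<Rightarrow> 'a::comm_ring_1) \<Rightarrow> nat set \<Rightarrow> 'a" where
  "pfaffian w V = (\<Sum>m\<in>perfect_matchings V. (- 1) ^ cross m * (\<Prod>(i, j)\<in>m. w i j))"

text \<open>Modulo 2, the vertices between \<open>i\<close> and \<open>j\<close> count the crossings
  of the new edge: a crossing edge has one endpoint there, a nested edge two.\<close>

lemma pfaffian_expand_between:
  fixes w :: "nat \<Rightarrow> nat \<Rightarrow> 'a::comm_ring_1"
  assumes "finite V" "i \<in> V"
  shows "pfaffian w V = (\<Sum>j\<in>V - {i}. (- 1) ^ card {v \<in> V - {i, j}. min i j < v \<and> v < max i j}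
    * w (min i j) (max i j) * pfaffian w (V - {i, j}))"
proof -
  define t :: "(nat \<times> nat) set \<Rightarrow> 'a" where "t m = (- 1) ^ cross m * (\<Prod>(i, j)\<in>m. w i j)" for m
  have t_insert: "t (insert (edge i j) m) =
      (- 1) ^ card {v \<in> V - {i, j}. min i j < v \<and> v < max i j} * w (min i j) (max i j) * t m"
    if j: "j \<in> V" "j \<noteq> i" and m: "m \<in> perfect_matchings (V - {i, j})" for j m
  proof -
    let ?W = "V - {i, j}" and ?e = "edge i j"
    have fin: "finite ?W" "finite m" using assms finite_perfect_matching[OF m] by auto
    have lt: "min i j \<notin> ?W" "max i j \<notin> ?W" "min i j < max i j" using j by (auto simp: min_def max_def)
    have notin: "?e \<notin> m" using perfect_matchings_memD(1)[OF m, of "min i j" "max i j"] lt(1) by (auto simp: edge_def)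
    have "(- 1 :: 'a) ^ card {v \<in> ?W. min i j < v \<and> v < max i j} =
        (- 1) ^ (\<Sum>q\<in>m. of_bool (crossing ?e q) + of_bool (crossing q ?e))"
      using lt by (subst card_between[OF m fin(1)])
        (simp_all only: sum.distrib sum_distrib_left[symmetric] edge_def power_add power_mult power2_eq_square
          power_one mult_minus_left mult_minus_right minus_minus mult_1_right simp_thms)
    hence "(- 1 :: 'a) ^ cross (insert ?e m) = (- 1) ^ card {v \<in> ?W. min i j < v \<and> v < max i j} * (- 1) ^ cross m"
      by (simp only: cross_insert[OF fin(2) notin] power_add mult.commute)
    thus ?thesis using fin notin by (simp add: t_def edge_def mult_ac)
  qed
  have "pfaffian w V = (\<Sum>m\<in>perfect_matchings V. t m)" by (simp add: pfaffian_def t_def)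
  also have "\<dots> = (\<Sum>x\<in>(SIGMA j:V - {i}. perfect_matchings (V - {i, j})). t ((\<lambda>(j, m). insert (edge i j) m) x))"
    by (rule sum.reindex_bij_betw[OF bij_betw_insert_edge, OF assms(2), symmetric])
  also have "\<dots> = (\<Sum>j\<in>V - {i}. \<Sum>m\<in>perfect_matchings (V - {i, j}). t (insert (edge i j) m))"
    using assms by (subst sum.Sigma) (auto intro: finite_perfect_matchings simp: case_prod_unfold)
  also have "\<dots> = (\<Sum>j\<in>V - {i}. (- 1) ^ card {v \<in> V - {i, j}. min i j < v \<and> v < max i j}
      * w (min i j) (max i j) * pfaffian w (V - {i, j}))"
    by (rule sum.cong[OF refl]) (simp add: t_insert pfaffian_def sum_distrib_left t_def[symmetric])
  finally show ?thesis .
qed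

section \<open>Signs from ranks and the expansion along a row\<close>

definition rank_sign :: "nat set \<Rightarrow> nat \<Rightarrow> 'a::comm_ring_1" where
  "rank_sign V i = (- 1) ^ card {v \<in> V. v < i}"

definition order_sign :: "nat \<Rightarrow> nat \<Rightarrow> 'a::comm_ring_1" where
  "order_sign i j = (if i < j then 1 else - 1)"

text \<open>Together with \<open>order_sign\<close> this treats partners on both sides alike: for
  \<open>i \<noteq> j\<close>, \<open>order_sign i j * skew w i j\<close> is the entry above the
  diagonal.\<close>

definition skew :: "(nat \<Rightarrow> nat \<Rightarrow> 'a::comm_ring_1) \<Rightarrow> nat \<Rightarrow> nat \<Rightarrow> 'a" where
  "skew w i j = (if i < j then w i j else if j < i then - w j i else 0)"

lemma skew_same [simp]: "skew w i i = 0"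
  by (simp add: skew_def)

lemma skew_swap: "skew w j i = - skew w i j"
  by (simp add: skew_def)

lemma order_sign_swap: "i \<noteq> j \<Longrightarrow> order_sign j i = - order_sign i j"
  by (simp add: order_sign_def)

lemma order_sign_square [simp]: "order_sign i j * order_sign i j = 1"
  by (simp add: order_sign_def)

lemma order_sign_cancel [simp]: "order_sign i j * (order_sign i j * x) = x"
  by (simp add: order_sign_def)

lemma rank_sign_square [simp]: "rank_sign V i * rank_sign V i = 1"
  by (simp add: rank_sign_def flip: power_mult_distrib)

lemma rank_sign_insert:
  assumes "finite V" "i \<notin> V" "i \<noteq> j"
  shows "rank_sign (insert i V) j = - order_sign i j * rank_sign V j"
proof -
  have "{v \<in> insert i V. v < j} = (if i < j then insert i {v \<in> V. v < j} else {v \<in> V. v < j})"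
    using assms by auto
  thus ?thesis using assms by (simp add: rank_sign_def order_sign_def)
qed

lemma rank_sign_insert_same: "rank_sign (insert i V) i = rank_sign V i"
proof -
  have "{v \<in> insert i V. v < i} = {v \<in> V. v < i}" by auto
  thus ?thesis by (simp add: rank_sign_def)
qed

text \<open>For \<open>i < j\<close>, the vertices below \<open>j\<close> are those below
  \<open>i\<close>, the vertex \<open>i\<close> itself, which causes the minus sign, and those in
  between. The sign thus splits into factors depending on one index each, as needed for swapping
  double sums.\<close>

lemma between_sign:
  assumes "finite V" "i \<in> V" "j \<in> V" "i \<noteq> j"
  shows "(- 1) ^ card {v \<in> V - {i, j}. min i j < v \<and> v < max i j} = - (rank_sign V i * rank_sign V j :: 'a::comm_ring_1)"
proof -
  have *: "(- 1) ^ card {v \<in> V - {i, j}. i < v \<and> v < j} = - (rank_sign V i * rank_sign V j :: 'a)"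
    if "i \<in> V" "i < j" for i j
  proof -
    let ?B = "{v \<in> V - {i, j}. i < v \<and> v < j}"
    have "{v \<in> V. v < j} = {v \<in> V. v < i} \<union> insert i ?B" using that by auto
    also have "card \<dots> = card {v \<in> V. v < i} + card (insert i ?B)"
      using \<open>finite V\<close> by (intro card_Un_disjoint) auto
    finally have "card {v \<in> V. v < j} = card {v \<in> V. v < i} + card (insert i ?B)" .
    hence "rank_sign V j = - (rank_sign V i * (- 1) ^ card ?B :: 'a)"
      using \<open>finite V\<close> by (simp add: rank_sign_def power_add)
    thus ?thesis by (simp add: mult.assoc[symmetric])
  qed
  show ?thesis
  proof (cases "i < j")
    case False
    hence "j < i" using assms by simp
    thus ?thesis using *[of j i] assms by (simp add: insert_commute mult.commute)
  qed (use * assms in simp)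
qed

lemma pfaffian_expand:
  fixes w :: "nat \<Rightarrow> nat \<Rightarrow> 'a::comm_ring_1"
  assumes "finite V" "i \<in> V"
  shows "pfaffian w V = - rank_sign V i *
    (\<Sum>j\<in>V - {i}. order_sign i j * rank_sign V j * skew w i j * pfaffian w (V - {i, j}))"
  unfolding pfaffian_expand_between[OF assms] sum_distrib_left
proof (rule sum.cong[OF refl])
  fix j assume j: "j \<in> V - {i}"
  hence "w (min i j) (max i j) = order_sign i j * skew w i j"
    by (auto simp: order_sign_def skew_def min_def max_def)
  thus "(- 1) ^ card {v \<in> V - {i, j}. min i j < v \<and> v < max i j} * w (min i j) (max i j) * pfaffian w (V - {i, j})
    = - rank_sign V i * (order_sign i j * rank_sign V j * skew w i j * pfaffian w (V - {i, j}))"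
    using between_sign[of V i j, where 'a = 'a] assms j by simp
qed

text \<open>
  Up to sign, this is the expansion of the Pfaffian of \<open>V\<close> extended by one more row \<open>i\<close>;
  so it vanishes if the row is repeated.
\<close>

definition row_sum :: "(nat \<Rightarrow> nat \<Rightarrow> 'a::comm_ring_1) \<Rightarrow> nat \<Rightarrow> nat set \<Rightarrow> 'a" where
  "row_sum w i V = (\<Sum>j\<in>V. rank_sign V j * skew w i j * pfaffian w (V - {j}))"

text \<open>Inserting \<open>i\<close> changes the rank of \<open>j\<close> exactly when
  \<open>i < j\<close>; this absorbs the factor \<open>order_sign i j\<close> of the expansion along
  \<open>i\<close>.\<close>

lemma row_sum_notin:
  fixes w :: "nat \<Rightarrow> nat \<Rightarrow> 'a::comm_ring_1"
  assumes "finite V" "i \<notin> V"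
  shows "row_sum w i V = rank_sign V i * pfaffian w (insert i V)"
proof -
  have "rank_sign V j = - order_sign i j * (rank_sign (insert i V) j :: 'a)" if "j \<in> V" for j
  proof -
    have "i \<noteq> j" using that assms by auto
    thus ?thesis by (simp add: rank_sign_insert[OF assms] mult.assoc[symmetric])
  qed
  moreover have "insert i V - {i, j} = V - {j}" for j using assms by auto
  ultimately have "row_sum w i V = - (\<Sum>j\<in>V. order_sign i j * rank_sign (insert i V) j * skew w i j
      * pfaffian w (insert i V - {i, j}))"
    unfolding row_sum_def sum_negf[symmetric] by (intro sum.cong refl) simp
  also have "\<dots> = rank_sign V i * pfaffian w (insert i V)"
    using assms by (subst pfaffian_expand[of _ i]) (simp_all add: rank_sign_insert_same mult.assoc[symmetric])
  finally show ?thesis .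
qed

text \<open>A second expansion along \<open>i\<close> of each remaining Pfaffian gives a double sum
  over \<open>j\<close> and \<open>k\<close> in which \<open>f j k\<close> is symmetric and
  \<open>order_sign j k\<close> antisymmetric.\<close>

lemma row_sum_in:
  fixes w :: "nat \<Rightarrow> nat \<Rightarrow> 'a::comm_ring_1"
  assumes "finite V" "i \<in> V"
  shows "row_sum w i V = 0"
proof -
  let ?W = "V - {i}"
  define f :: "nat \<Rightarrow> nat \<Rightarrow> 'a" where "f j k = rank_sign ?W j * rank_sign ?W k * skew w i j * skew w i k
      * pfaffian w (?W - {j, k})" for j k
  have row_sum: "row_sum w i V = rank_sign ?W i * (\<Sum>j\<in>?W. \<Sum>k\<in>?W - {j}. order_sign j k * f j k)"
  proof -
    have "row_sum w i V = (\<Sum>j\<in>?W. rank_sign V j * skew w i j * pfaffian w (V - {j}))"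
      unfolding row_sum_def using assms by (intro sum.mono_neutral_right) auto
    also have "\<dots> = (\<Sum>j\<in>?W. \<Sum>k\<in>?W - {j}. rank_sign ?W i * (order_sign j k * f j k))"
    proof (rule sum.cong[OF refl])
      fix j assume j: "j \<in> ?W"
      have V: "V = insert i ?W" "?W = insert j (?W - {j})" and ij: "i \<noteq> j" "j \<noteq> i" using assms j by auto
      have "pfaffian w (V - {j}) = - rank_sign (V - {j}) i *
          (\<Sum>k\<in>V - {j} - {i}. order_sign i k * rank_sign (V - {j}) k * skew w i k * pfaffian w (V - {j} - {i, k}))"
        using assms j by (intro pfaffian_expand) auto
      also have "V - {j} - {i} = ?W - {j}" by auto
      finally have pf: "pfaffian w (V - {j}) = - rank_sign (V - {j}) i *
          (\<Sum>k\<in>?W - {j}. order_sign i k * rank_sign (V - {j}) k * skew w i k * pfaffian w (V - {j} - {i, k}))" .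
      \<comment> \<open>The ranks are rewritten relative to \<open>?W\<close>. The two factors
        \<open>order_sign i j\<close> cancel, and so do the two factors
        \<open>order_sign i k\<close>; only \<open>order_sign j k\<close> survives.\<close>
      have [simp]: "rank_sign V j = - order_sign i j * (rank_sign ?W j :: 'a)"
        using rank_sign_insert[of ?W i j] assms ij V by simp
      have "rank_sign ?W i = - order_sign j i * (rank_sign (?W - {j}) i :: 'a)"
        using rank_sign_insert[of "?W - {j}" j i] assms ij V by simp
      moreover have "V - {j} = insert i (?W - {j})" using assms ij by auto
      ultimately have [simp]: "rank_sign (V - {j}) i = order_sign i j * (rank_sign ?W i :: 'a)"
        using ij by (simp add: rank_sign_insert_same order_sign_swap[of i j] mult.assoc[symmetric])
      have "rank_sign V j * skew w i j * pfaffian w (V - {j}) = (\<Sum>k\<in>?W - {j}. rank_sign ?W j * skew w i j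
          * rank_sign ?W i * (order_sign i k * rank_sign (V - {j}) k * skew w i k * pfaffian w (V - {j} - {i, k})))"
      proof -
        have "- order_sign i j * (rank_sign ?W j :: 'a) * skew w i j * (- (order_sign i j * rank_sign ?W i) * x)
            = rank_sign ?W j * skew w i j * rank_sign ?W i * x" for x
          by (simp add: mult_ac)
        thus ?thesis by (simp add: pf sum_distrib_left del: mult_minus_left mult_minus_right)
      qed
      also have "\<dots> = (\<Sum>k\<in>?W - {j}. rank_sign ?W i * (order_sign j k * f j k))"
      proof (rule sum.cong[OF refl])
        fix k assume k: "k \<in> ?W - {j}"
        have kij: "i \<noteq> k" "j \<noteq> k" using k by auto
        have "rank_sign ?W k = - order_sign j k * (rank_sign (?W - {j}) k :: 'a)"
          using rank_sign_insert[of "?W - {j}" j k] assms kij V by simp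
        moreover have "rank_sign (V - {j}) k = - order_sign i k * (rank_sign (?W - {j}) k :: 'a)"
          using rank_sign_insert[of "?W - {j}" i k] \<open>V - {j} = insert i (?W - {j})\<close> assms kij by simp
        moreover have "V - {j} - {i, k} = ?W - {j, k}" by auto
        moreover have "order_sign i k * (- order_sign i k * x) = - x" "order_sign j k * (- order_sign j k * x) = - x" for x :: 'a
          by (simp_all add: mult.assoc[symmetric])
        ultimately show "rank_sign ?W j * skew w i j * rank_sign ?W i
            * (order_sign i k * rank_sign (V - {j}) k * skew w i k * pfaffian w (V - {j} - {i, k}))
          = rank_sign ?W i * (order_sign j k * f j k)"
          by (simp add: f_def mult_ac)
      qed
      finally show "rank_sign V j * skew w i j * pfaffian w (V - {j})
        = (\<Sum>k\<in>?W - {j}. rank_sign ?W i * (order_sign j k * f j k))" .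
    qed
    finally show ?thesis by (simp add: sum_distrib_left)
  qed
  \<comment> \<open>Being equal to its own negative would not make the sum zero in a ring where 2
    may be a zero divisor. So the terms with \<open>j < k\<close> and those with
    \<open>k < j\<close> are separated and cancelled against each other.\<close>
  have "(\<Sum>j\<in>?W. \<Sum>k\<in>?W - {j}. order_sign j k * f j k)
      = (\<Sum>j\<in>?W. \<Sum>k\<in>?W. if j < k then f j k else if k < j then - f j k else 0)"
  proof (rule sum.cong[OF refl])
    fix j assume "j \<in> ?W"
    have "(\<Sum>k\<in>?W - {j}. order_sign j k * f j k) = (\<Sum>k\<in>?W - {j}. if j < k then f j k else if k < j then - f j k else 0)"
      by (rule sum.cong) (auto simp: order_sign_def)
    also have "\<dots> = (\<Sum>k\<in>?W. if j < k then f j k else if k < j then - f j k else 0)"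
      using assms by (intro sum.mono_neutral_left) auto
    finally show "(\<Sum>k\<in>?W - {j}. order_sign j k * f j k) = \<dots>" .
  qed
  also have "\<dots> = (\<Sum>j\<in>?W. \<Sum>k\<in>?W. if j < k then f j k else 0) - (\<Sum>j\<in>?W. \<Sum>k\<in>?W. if k < j then f j k else 0)"
    by (simp add: sum_subtractf[symmetric]) (intro sum.cong; auto)
  also have "(\<Sum>j\<in>?W. \<Sum>k\<in>?W. if k < j then f j k else 0) = (\<Sum>k\<in>?W. \<Sum>j\<in>?W. if k < j then f j k else 0)"
    by (rule sum.swap)
  also have "\<dots> = (\<Sum>j\<in>?W. \<Sum>k\<in>?W. if j < k then f j k else 0)"
    by (intro sum.cong refl) (simp add: f_def mult_ac insert_commute)
  finally show ?thesis by (simp add: row_sum)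
qed

text \<open>Each inner sum is a \<open>row_sum\<close>: it vanishes at indices common to
  \<open>U\<close> and \<open>V\<close>, which leaves the set differences, and is a Pfaffian
  elsewhere. The minus sign is the skew-symmetry of the entry joining \<open>i\<close> and
  \<open>j\<close>.\<close>

lemma pfaffian_exchange:
  fixes w :: "nat \<Rightarrow> nat \<Rightarrow> 'a::comm_ring_1"
  assumes "finite U" "finite V"
  shows "(\<Sum>i\<in>U - V. rank_sign U i * rank_sign V i * pfaffian w (U - {i}) * pfaffian w (insert i V))
    = - (\<Sum>j\<in>V - U. rank_sign U j * rank_sign V j * pfaffian w (V - {j}) * pfaffian w (insert j U))"
proof -
  have half: "(\<Sum>i\<in>A - B. rank_sign A i * rank_sign B i * pfaffian w (A - {i}) * pfaffian w (insert i B))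
      = (\<Sum>i\<in>A. rank_sign A i * pfaffian w (A - {i}) * row_sum w i B)" if "finite A" "finite B" for A B
  proof -
    have "(\<Sum>i\<in>A - B. rank_sign A i * rank_sign B i * pfaffian w (A - {i}) * pfaffian w (insert i B))
        = (\<Sum>i\<in>A - B. rank_sign A i * pfaffian w (A - {i}) * row_sum w i B)"
      using that by (intro sum.cong) (auto simp: row_sum_notin mult_ac)
    also have "\<dots> = (\<Sum>i\<in>A. rank_sign A i * pfaffian w (A - {i}) * row_sum w i B)"
      using that by (intro sum.mono_neutral_left) (auto simp: row_sum_in)
    finally show ?thesis .
  qed
  have "(\<Sum>i\<in>U. rank_sign U i * pfaffian w (U - {i}) * row_sum w i V)
      = (\<Sum>i\<in>U. \<Sum>j\<in>V. rank_sign U i * pfaffian w (U - {i}) * (rank_sign V j * skew w i j * pfaffian w (V - {j})))"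
    by (simp add: row_sum_def sum_distrib_left)
  also have "\<dots> = (\<Sum>j\<in>V. \<Sum>i\<in>U. rank_sign U i * pfaffian w (U - {i}) * (rank_sign V j * skew w i j * pfaffian w (V - {j})))"
    by (rule sum.swap)
  also have "\<dots> = - (\<Sum>j\<in>V. rank_sign V j * pfaffian w (V - {j}) * row_sum w j U)"
    unfolding row_sum_def sum_distrib_left sum_negf[symmetric]
  proof (intro sum.cong refl)
    fix i j
    show "rank_sign U i * pfaffian w (U - {i}) * (rank_sign V j * skew w i j * pfaffian w (V - {j}))
        = - (rank_sign V j * pfaffian w (V - {j}) * (rank_sign U i * skew w j i * pfaffian w (U - {i})))"
      unfolding skew_swap[of w j i] by (simp add: mult_ac)
  qed
  finally show ?thesis
    using half[OF assms] half[OF assms(2,1)] by (simp add: mult_ac)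
qed

lemma pfaffian_pluecker:
  fixes w :: "nat \<Rightarrow> nat \<Rightarrow> 'a::comm_ring_1"
  assumes N: "N = 2 * k + 4" and V: "V = {1..N}"
  shows "pfaffian w (V - {1, 2, N - 1, N}) * pfaffian w V =
    pfaffian w (V - {1, 2}) * pfaffian w (V - {N - 1, N})
    - pfaffian w (V - {1, N - 1}) * pfaffian w (V - {2, N})
    + pfaffian w (V - {1, N}) * pfaffian w (V - {2, N - 1})"
proof -
  \<comment> \<open>The only index of \<open>?U\<close> outside \<open>?W\<close> is 1, which yields
    the single product on the left; the indices 2, \<open>N - 1\<close> and \<open>N\<close> of
    \<open>?W\<close> outside \<open>?U\<close> yield the three on the right.\<close>
  let ?U = "V - {2, N - 1, N}" and ?W = "V - {1}"
  have diff: "?U - ?W = {1}" "?W - ?U = {2, N - 1, N}" using N V by auto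
  have ins: "insert 1 ?W = V" "insert 1 V = V" "?U - {1} = V - {1, 2, N - 1, N}"
    "?W - {2} = V - {1, 2}" "?W - {N - 1} = V - {1, N - 1}" "?W - {N} = V - {1, N}"
    "insert 2 ?U = V - {N - 1, N}" "insert (N - 1) ?U = V - {2, N}" "insert N ?U = V - {2, N - 1}"
    using N V by auto
  have sets: "{v \<in> ?U. v < 1} = {}" "{v \<in> ?W. v < 1} = {}" "{v \<in> ?U. v < 2} = {1}" "{v \<in> ?W. v < 2} = {}"
    "{v \<in> ?U. v < N - 1} = insert 1 {3..N - 2}" "{v \<in> ?W. v < N - 1} = {2..N - 2}"
    "{v \<in> ?U. v < N} = insert 1 {3..N - 2}" "{v \<in> ?W. v < N} = {2..N - 1}"
    using N V by auto
  \<comment> \<open>Since \<open>N\<close> is even, the products of the two signs at 2,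
    \<open>N - 1\<close>, \<open>N\<close> are -1, 1, -1. The minus sign of
    \<open>pfaffian_exchange\<close> turns them into the pattern +, -, + of the relation.\<close>
  have signs: "rank_sign ?U 1 = (1 :: 'a)" "rank_sign ?W 1 = (1 :: 'a)" "rank_sign ?U 2 = (- 1 :: 'a)" "rank_sign ?W 2 = (1 :: 'a)"
    "rank_sign ?U (N - 1) = (- 1 :: 'a)" "rank_sign ?W (N - 1) = (- 1 :: 'a)"
    "rank_sign ?U N = (- 1 :: 'a)" "rank_sign ?W N = (1 :: 'a)"
    unfolding rank_sign_def sets by (simp_all add: N)
  have neq: "2 \<noteq> N - 1" "2 \<noteq> N" "N - 1 \<noteq> N" using N by auto
  have "finite ?U" "finite ?W" using V by auto
  from pfaffian_exchange[OF this, of w, unfolded diff] neq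
  show ?thesis by (simp add: ins signs del: One_nat_def)
qed

section \<open>Relabelling and rescaling\<close>

lemma inj_on_map_prod_edges:
  fixes g :: "nat \<Rightarrow> nat"
  assumes "strict_mono g" shows "inj_on (map_prod g g) m"
  by (auto simp: inj_on_def strict_mono_eq[OF assms])

lemma relabel_perfect_matching_iff:
  fixes g :: "nat \<Rightarrow> nat"
  assumes g: "strict_mono g" and m: "m \<subseteq> V \<times> V"
  shows "map_prod g g ` m \<in> perfect_matchings (g ` V) \<longleftrightarrow> m \<in> perfect_matchings V"
proof
  note inj = strict_mono_eq[OF g]
  assume m': "map_prod g g ` m \<in> perfect_matchings (g ` V)"
  show "m \<in> perfect_matchings V"
  proof (rule perfect_matchingsI)
    fix a b assume ab: "(a, b) \<in> m"
    hence "(g a, g b) \<in> map_prod g g ` m" by force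
    thus "a \<in> V \<and> b \<in> V \<and> a < b"
      using perfect_matchings_memD(3)[OF m'] ab m strict_mono_less[OF g] by blast
  next
    fix v assume "v \<in> V"
    then obtain p where "p \<in> map_prod g g ` m" "g v = fst p \<or> g v = snd p"
      using perfect_matchings_ex[OF m', of "g v"] by blast
    then obtain q where "q \<in> m" "v = fst q \<or> v = snd q" by (auto simp: inj)
    thus "\<exists>p\<in>m. v = fst p \<or> v = snd p" by blast
  next
    fix v p q assume pq: "p \<in> m" "q \<in> m" "v = fst p \<or> v = snd p" "v = fst q \<or> v = snd q"
    hence "map_prod g g p = map_prod g g q"
      by (intro perfect_matchings_unique[OF m', of _ _ "g v"]) auto
    thus "p = q" by (simp add: prod_eq_iff inj)
  qed
next
  note inj = strict_mono_eq[OF g]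
  assume m': "m \<in> perfect_matchings V"
  show "map_prod g g ` m \<in> perfect_matchings (g ` V)"
  proof (rule perfect_matchingsI)
    fix a b assume "(a, b) \<in> map_prod g g ` m"
    then obtain c d where "(c, d) \<in> m" "a = g c" "b = g d" by auto
    thus "a \<in> g ` V \<and> b \<in> g ` V \<and> a < b"
      using perfect_matchings_memD[OF m', of c d] strict_mono_less[OF g] by simp
  next
    fix v assume "v \<in> g ` V"
    then obtain u where u: "u \<in> V" "v = g u" by blast
    then obtain p where "p \<in> m" "u = fst p \<or> u = snd p"
      using perfect_matchings_ex[OF m', of u] by blast
    thus "\<exists>p\<in>map_prod g g ` m. v = fst p \<or> v = snd p"
      using u by (intro bexI[of _ "map_prod g g p"]) auto
  next
    fix v p q assume im: "p \<in> map_prod g g ` m" "q \<in> map_prod g g ` m"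
      and v: "v = fst p \<or> v = snd p" "v = fst q \<or> v = snd q"
    from im(1) obtain p' where p': "p' \<in> m" "p = map_prod g g p'" by (rule imageE)
    from im(2) obtain q' where q': "q' \<in> m" "q = map_prod g g q'" by (rule imageE)
    obtain u where u: "v = g u" "u = fst p' \<or> u = snd p'" using v(1) p'(2) by fastforce
    moreover have "u = fst q' \<or> u = snd q'" using v(2) unfolding q'(2) u(1) by (simp add: inj)
    ultimately have "p' = q'"
      by (intro perfect_matchings_unique[OF m' p'(1) q'(1), of u])
    thus "p = q" using p'(2) q'(2) by simp
  qed
qed

lemma bij_betw_relabel_perfect_matchings:
  fixes g :: "nat \<Rightarrow> nat"
  assumes g: "strict_mono g"
  shows "bij_betw ((`) (map_prod g g)) (perfect_matchings V) (perfect_matchings (g ` V))"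
  unfolding bij_betw_def
proof
  show "inj_on ((`) (map_prod g g)) (perfect_matchings V)"
    using inj_on_map_prod_edges[OF g, of UNIV] by (intro inj_onI) (simp add: inj_image_eq_iff)
  show "(`) (map_prod g g) ` perfect_matchings V = perfect_matchings (g ` V)"
  proof (intro equalityI subsetI)
    fix m assume m: "m \<in> perfect_matchings (g ` V)"
    have "m \<subseteq> map_prod g g ` (V \<times> V)"
      using perfect_matchings_memD(1,2)[OF m] by (auto simp: map_prod_surj_on)
    then obtain m' where "m' \<subseteq> V \<times> V" "m = map_prod g g ` m'" by (auto simp: subset_image_iff)
    thus "m \<in> (`) (map_prod g g) ` perfect_matchings V"
      using m relabel_perfect_matching_iff[OF g, of m' V] by blast
  next
    fix m assume "m \<in> (`) (map_prod g g) ` perfect_matchings V"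
    then obtain m' where m': "m' \<in> perfect_matchings V" "m = map_prod g g ` m'" by blast
    moreover have "m' \<subseteq> V \<times> V" using m'(1) by (auto simp: perfect_matchings_def)
    ultimately show "m \<in> perfect_matchings (g ` V)"
      using relabel_perfect_matching_iff[OF g, of m' V] by blast
  qed
qed

lemma cross_relabel:
  assumes g: "strict_mono g" and "finite m"
  shows "cross (map_prod g g ` m) = cross m"
proof -
  have "crossing (map_prod g g p) (map_prod g g q) \<longleftrightarrow> crossing p q" for p q
    by (simp add: crossing_def strict_mono_less[OF g])
  thus ?thesis
    using \<open>finite m\<close>
    by (simp add: cross_eq_sum sum.reindex inj_on_map_prod_edges[OF g] del: sum_of_bool_eq)
qed

lemma pfaffian_relabel:
  assumes g: "strict_mono g" and "finite V"
  shows "pfaffian w (g ` V) = pfaffian (\<lambda>i j. w (g i) (g j)) V"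
proof -
  have "pfaffian w (g ` V) = (\<Sum>m\<in>perfect_matchings V.
      (- 1) ^ cross (map_prod g g ` m) * (\<Prod>(i, j)\<in>map_prod g g ` m. w i j))"
    unfolding pfaffian_def by (rule sum.reindex_bij_betw[OF bij_betw_relabel_perfect_matchings[OF g], symmetric])
  also have "\<dots> = pfaffian (\<lambda>i j. w (g i) (g j)) V"
    unfolding pfaffian_def
  proof (rule sum.cong[OF refl])
    fix m assume "m \<in> perfect_matchings V"
    hence "finite m" using finite_perfect_matching assms by blast
    thus "(- 1) ^ cross (map_prod g g ` m) * (\<Prod>(i, j)\<in>map_prod g g ` m. w i j)
        = (- 1) ^ cross m * (\<Prod>(i, j)\<in>m. w (g i) (g j))"
      by (simp add: cross_relabel[OF g] prod.reindex[OF inj_on_map_prod_edges[OF g]] case_prod_unfold)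
  qed
  finally show ?thesis .
qed

section \<open>The lambda-weighted sum as a rescaled Pfaffian\<close>

definition lambda_sum :: "'a::comm_ring_1 \<Rightarrow> (nat \<Rightarrow> nat \<Rightarrow> 'a) \<Rightarrow> nat \<Rightarrow> 'a" where
  "lambda_sum l w k = (\<Sum>m\<in>perfect_matchings {1..2 * k}.
     (- 1) ^ cross m * l ^ (cross m + nest m) * (\<Prod>(i, j)\<in>m. w i j))"

text \<open>Here \<open>c\<close> is the common shift of the right endpoints, of which there are
  \<open>k\<close>, and \<open>d\<close> an extra shift of the last vertex, always a right endpoint.
  The condition on \<open>g\<close> starts at 2 because vertex 1 is always a left endpoint; hence
  deleting 1 or deleting 2 has the same effect when the other deleted index is one of the last
  two.\<close>

lemma pfaffian_rescaled:
  fixes g :: "nat \<Rightarrow> nat"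
  assumes g: "strict_mono g" and gj: "\<And>j. j \<in> {2..2 * k} \<Longrightarrow> g j = j + c + (if j = 2 * k then d else 0)"
    and d: "k > 0 \<or> d = 0"
  shows "pfaffian (\<lambda>i j. l ^ j * w i j) (g ` {1..2 * k})
    = l ^ (c * k + d + k * (k + 1)) * lambda_sum l (\<lambda>i j. w (g i) (g j)) k"
proof -
  have weight: "(\<Prod>(i, j)\<in>m. l ^ g j * w (g i) (g j))
      = l ^ (c * k + d + k * (k + 1)) * l ^ (cross m + nest m) * (\<Prod>(i, j)\<in>m. w (g i) (g j))"
    if m: "m \<in> perfect_matchings {1..2 * k}" for m
  proof -
    have "(\<Sum>(i, j)\<in>m. g j) = (\<Sum>(i, j)\<in>m. j + c + (if j = 2 * k then d else 0))"
    proof (rule sum.cong[OF refl], clarify)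
      fix i j assume "(i, j) \<in> m"
      hence "j \<in> {2..2 * k}" using perfect_matchings_memD[OF m, of i j] by auto
      thus "g j = j + c + (if j = 2 * k then d else 0)" by (rule gj)
    qed
    also have "\<dots> = (\<Sum>(i, j)\<in>m. j) + c * k + (\<Sum>(i, j)\<in>m. if j = 2 * k then d else 0)"
      using card_perfect_matching[OF m] by (simp add: sum.distrib case_prod_unfold)
    \<comment> \<open>The last vertex is never a left endpoint, so a term 0 for \<open>i\<close> can
      be added; the result is a sum over all vertices and picks up \<open>d\<close> once.\<close>
    also have "(\<Sum>(i, j)\<in>m. if j = 2 * k then d else 0)
        = (\<Sum>(i, j)\<in>m. (if i = 2 * k then d else 0) + (if j = 2 * k then d else 0))"
    proof (rule sum.cong[OF refl], clarify)
      fix i j assume "(i, j) \<in> m"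
      thus "(if j = 2 * k then d else 0) = (if i = 2 * k then d else 0) + (if j = 2 * k then d else 0)"
        using perfect_matchings_memD[OF m, of i j] by auto
    qed
    also have "\<dots> = (\<Sum>v\<in>{1..2 * k}. if v = 2 * k then d else 0)"
      by (rule sum_perfect_matching[OF m, symmetric]) simp
    also have "\<dots> = d" using d by auto
    finally have "(\<Sum>(i, j)\<in>m. g j) = c * k + d + k * (k + 1) + (cross m + nest m)"
      by (simp add: sum_right_endpoints[OF m])
    thus ?thesis by (simp add: case_prod_unfold prod.distrib power_sum[symmetric] power_add[symmetric] mult_ac add_ac)
  qed
  show ?thesis
    unfolding pfaffian_relabel[OF g finite_atLeastAtMost] unfolding pfaffian_def lambda_sum_def sum_distrib_left
    by (rule sum.cong[OF refl]) (simp only: weight mult_ac)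
qed

text \<open>For \<open>p < q\<close>, the increasing enumeration of the natural numbers other than
  \<open>p\<close> and \<open>q\<close>. Beyond \<open>p\<close> the candidate is
  \<open>x + 1\<close>, so this is what has to be compared with \<open>q\<close>.\<close>

definition skip :: "nat \<Rightarrow> nat \<Rightarrow> nat \<Rightarrow> nat" where
  "skip p q x = (if x < p then x else if x + 1 < q then x + 1 else x + 2)"

lemma strict_mono_skip: "p < q \<Longrightarrow> strict_mono (skip p q)"
  by (intro strict_monoI) (auto simp: skip_def)

lemma skip_image:
  assumes "1 \<le> p" "p < q" "q \<le> n + 2"
  shows "skip p q ` {1..n} = {1..n + 2} - {p, q}"
proof (intro equalityI subsetI)
  fix y assume y: "y \<in> {1..n + 2} - {p, q}"
  define x where "x = (if y < p then y else if y < q then y - 1 else y - 2)"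
  have "y = skip p q x" "x \<in> {1..n}" using y assms by (auto simp: x_def skip_def)
  thus "y \<in> skip p q ` {1..n}" by blast
qed (use assms in \<open>auto simp: skip_def\<close>)

lemma lambda_sum_recurrence:
  fixes l :: "'a::field" and w :: "nat \<Rightarrow> nat \<Rightarrow> 'a"
  assumes l: "l \<noteq> 0" and N: "N = 2 * k + 4"
  defines "S \<equiv> \<lambda>p q. lambda_sum l (\<lambda>i j. w (skip p q i) (skip p q j)) (k + 1)"
  shows "lambda_sum l (\<lambda>i j. w (i + 2) (j + 2)) k * lambda_sum l w (k + 2) =
    S 1 2 * S (N - 1) N - l * S 1 (N - 1) * S 2 N + l * S 1 N * S 2 (N - 1)"
proof -
  define B where "B = (\<lambda>i j. l ^ j * w i j)"
  define V where "V = {1..N}"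
  have pf: "pfaffian B (V - {p, q}) = l ^ (c * (k + 1) + d + (k + 1) * (k + 2)) * S p q"
    if "1 \<le> p" "p < q" "q \<le> N"
      and "\<And>j. j \<in> {2..2 * k + 2} \<Longrightarrow> skip p q j = j + c + (if j = 2 * k + 2 then d else 0)" for p q c d
  proof -
    have "V - {p, q} = skip p q ` {1..2 * (k + 1)}"
      using that N by (subst skip_image) (auto simp: V_def)
    thus ?thesis
      using pfaffian_rescaled[of "skip p q" "k + 1" c d l w] strict_mono_skip[of p q] that
      by (simp add: B_def S_def)
  qed
  have "V - {1, 2, N - 1, N} = (\<lambda>i. i + 2) ` {1..2 * k}"
    unfolding V_def N image_add_atLeastAtMost' by auto
  hence inner: "pfaffian B (V - {1, 2, N - 1, N}) =
      l ^ (2 * k + k * (k + 1)) * lambda_sum l (\<lambda>i j. w (i + 2) (j + 2)) k"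
    using pfaffian_rescaled[of "\<lambda>i. i + 2" k 2 0 l w] by (simp add: B_def strict_mono_def)
  have full: "pfaffian B V = l ^ ((k + 2) * (k + 3)) * lambda_sum l w (k + 2)"
  proof -
    have "pfaffian B ((\<lambda>i. i) ` {1..2 * (k + 2)}) = l ^ (0 * (k + 2) + 0 + (k + 2) * (k + 2 + 1)) * lambda_sum l w (k + 2)"
      unfolding B_def by (rule pfaffian_rescaled) (auto simp: strict_mono_def)
    moreover have "(\<lambda>i. i) ` {1..2 * (k + 2)} = V" "0 * (k + 2) + 0 + (k + 2) * (k + 2 + 1) = (k + 2) * (k + 3)"
      by (simp_all add: V_def N algebra_simps)
    ultimately show ?thesis by (simp only:)
  qed
  \<comment> \<open>The power of \<open>l\<close> in the left-hand product, and also in the first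
    product on the right. Each of the other two contains a factor where \<open>N - 1\<close> is
    deleted but \<open>N\<close> is kept, so the last right endpoint moves one further; this extra
    \<open>l\<close> is the coefficient in the recurrence.\<close>
  let ?L = "l ^ (2 * k + k * (k + 1) + (k + 2) * (k + 3))"
  have "?L * (lambda_sum l (\<lambda>i j. w (i + 2) (j + 2)) k * lambda_sum l w (k + 2)) =
      pfaffian B (V - {1, 2, N - 1, N}) * pfaffian B V"
    unfolding inner full power_add by (simp only: mult_ac)
  also have "\<dots> = pfaffian B (V - {1, 2}) * pfaffian B (V - {N - 1, N})
    - pfaffian B (V - {1, N - 1}) * pfaffian B (V - {2, N})
    + pfaffian B (V - {1, N}) * pfaffian B (V - {2, N - 1})"
    by (rule pfaffian_pluecker[OF N V_def])
  \<comment> \<open>The exponents stay unsimplified so that unification with \<open>pf\<close> reads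
    off \<open>c\<close> and \<open>d\<close>.\<close>
  also have "pfaffian B (V - {1, 2}) = l ^ (2 * (k + 1) + 0 + (k + 1) * (k + 2)) * S 1 2"
    by (rule pf) (auto simp: skip_def N)
  also have "pfaffian B (V - {N - 1, N}) = l ^ (0 * (k + 1) + 0 + (k + 1) * (k + 2)) * S (N - 1) N"
    by (rule pf) (auto simp: skip_def N)
  also have "pfaffian B (V - {1, N - 1}) = l ^ (1 * (k + 1) + 1 + (k + 1) * (k + 2)) * S 1 (N - 1)"
    by (rule pf) (auto simp: skip_def N)
  also have "pfaffian B (V - {2, N}) = l ^ (1 * (k + 1) + 0 + (k + 1) * (k + 2)) * S 2 N"
    by (rule pf) (auto simp: skip_def N)
  also have "pfaffian B (V - {1, N}) = l ^ (1 * (k + 1) + 0 + (k + 1) * (k + 2)) * S 1 N"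
    by (rule pf) (auto simp: skip_def N)
  also have "pfaffian B (V - {2, N - 1}) = l ^ (1 * (k + 1) + 1 + (k + 1) * (k + 2)) * S 2 (N - 1)"
    by (rule pf) (auto simp: skip_def N)
  also have "l ^ (2 * (k + 1) + 0 + (k + 1) * (k + 2)) * S 1 2 * (l ^ (0 * (k + 1) + 0 + (k + 1) * (k + 2)) * S (N - 1) N)
      - l ^ (1 * (k + 1) + 1 + (k + 1) * (k + 2)) * S 1 (N - 1) * (l ^ (1 * (k + 1) + 0 + (k + 1) * (k + 2)) * S 2 N)
      + l ^ (1 * (k + 1) + 0 + (k + 1) * (k + 2)) * S 1 N * (l ^ (1 * (k + 1) + 1 + (k + 1) * (k + 2)) * S 2 (N - 1))
    = ?L * (S 1 2 * S (N - 1) N - l * S 1 (N - 1) * S 2 N + l * S 1 N * S 2 (N - 1))"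
  proof -
    have *: "l ^ a * x * (l ^ b * y) = l ^ (a + b) * (x * y)" for a b x y
      by (simp add: power_add mult_ac)
    have e: "2 * (k + 1) + 0 + (k + 1) * (k + 2) + (0 * (k + 1) + 0 + (k + 1) * (k + 2))
        = 2 * k + k * (k + 1) + (k + 2) * (k + 3)"
      "1 * (k + 1) + 1 + (k + 1) * (k + 2) + (1 * (k + 1) + 0 + (k + 1) * (k + 2))
        = Suc (2 * k + k * (k + 1) + (k + 2) * (k + 3))"
      "1 * (k + 1) + 0 + (k + 1) * (k + 2) + (1 * (k + 1) + 1 + (k + 1) * (k + 2))
        = Suc (2 * k + k * (k + 1) + (k + 2) * (k + 3))"
      by (simp_all add: algebra_simps)
    show ?thesis unfolding * e by (simp only: power_Suc ring_distribs right_diff_distrib mult_ac)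
  qed
  finally show ?thesis using l by (simp only: mult_cancel_left power_eq_0_iff simp_thms)
qed

section \<open>The recurrence for matrices\<close>

definition weight_mat :: "(nat \<Rightarrow> nat \<Rightarrow> 'a) \<Rightarrow> nat \<Rightarrow> 'a mat" where
  "weight_mat w N = mat N N (\<lambda>(i, j). w (Suc i) (Suc j))"

text \<open>Both \<open>g\<close> and \<open>pick\<close> enumerate the surviving indices in
  increasing order, from 1 and from 0 respectively. Deletion thus becomes composition of
  \<open>w\<close> with \<open>g\<close>.\<close>

lemma del_weight_mat:
  fixes g :: "nat \<Rightarrow> nat" and w :: "nat \<Rightarrow> nat \<Rightarrow> 'a"
  assumes g: "strict_mono g" and im: "g ` {1..m} = {1..n} - I"
  shows "del (weight_mat w n) I = weight_mat (\<lambda>i j. w (g i) (g j)) m"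
proof -
  define S where "S = {k. Suc k \<notin> I}"
  have S: "a \<in> S \<longleftrightarrow> Suc a \<notin> I" for a by (simp add: S_def)
  \<comment> \<open>An element of \<open>S\<close> with exactly \<open>x\<close> elements of
    \<open>S\<close> below it is \<open>pick S x\<close>. The set \<open>S\<close> is not cut off at
    \<open>n\<close>, but everything below \<open>g (Suc x) - 1\<close> is in range.\<close>
  have below: "{a \<in> S. a < g (Suc x) - 1} = (\<lambda>i. g (Suc i) - 1) ` {..<x}" if "x < m" for x
  proof (intro equalityI subsetI)
    have gx: "g (Suc x) \<le> n" using im that by auto
    fix a assume a: "a \<in> {a \<in> S. a < g (Suc x) - 1}"
    hence "Suc a \<in> {1..n} - I" using gx by (auto simp: S)
    then obtain i where i: "i \<in> {1..m}" "Suc a = g i" using im by (metis imageE)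
    hence "i < Suc x" using a strict_mono_less[OF g, of i "Suc x"] by auto
    thus "a \<in> (\<lambda>i. g (Suc i) - 1) ` {..<x}"
      using i by (intro image_eqI[of _ _ "i - 1"]) (auto simp flip: i(2))
  next
    fix a assume "a \<in> (\<lambda>i. g (Suc i) - 1) ` {..<x}"
    then obtain i where i: "i < x" "a = g (Suc i) - 1" by auto
    have "g (Suc i) \<in> g ` {1..m}" using i that by auto
    hence "g (Suc i) \<in> {1..n} - I" using im by simp
    thus "a \<in> {a \<in> S. a < g (Suc x) - 1}"
      using i strict_mono_less[OF g, of "Suc i" "Suc x"] by (auto simp: S)
  qed
  have pos: "g (Suc i) \<ge> 1" for i using strict_mono_imp_increasing[OF g, of "Suc i"] by simp
  have inj: "inj_on (\<lambda>i. g (Suc i) - 1) A" for A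
  proof (rule inj_onI)
    fix x y assume "g (Suc x) - 1 = g (Suc y) - 1"
    hence "g (Suc x) = g (Suc y)" using pos[of x] pos[of y] by linarith
    thus "x = y" using strict_mono_eq[OF g] by blast
  qed
  have pick: "pick S x = g (Suc x) - 1" if "x < m" for x
  proof -
    have "g (Suc x) \<in> g ` {1..m}" using that by auto
    hence "g (Suc x) - 1 \<in> S" using im by (auto simp: S)
    from pick_card_in_set[OF this] show ?thesis
      by (simp only: below[OF that] card_image[OF inj] card_lessThan)
  qed
  have "{i. i < n \<and> i \<in> S} = (\<lambda>i. i - 1) ` ({1..n} - I)"
  proof (intro equalityI subsetI)
    fix i assume "i \<in> {i. i < n \<and> i \<in> S}"
    thus "i \<in> (\<lambda>i. i - 1) ` ({1..n} - I)" by (intro image_eqI[of _ _ "Suc i"]) (auto simp: S)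
  qed (auto simp: S)
  hence "card {i. i < n \<and> i \<in> S} = card ({1..n} - I)"
    by (simp only:) (rule card_image, auto simp: inj_on_def)
  also have "\<dots> = m" unfolding im[symmetric] using strict_mono_imp_inj_on[OF g, of "{1..m}"]
    by (subst card_image) auto
  finally have card: "card {i. i < n \<and> i \<in> S} = m" .
  have lt: "g (Suc x) - 1 < n" "Suc (g (Suc x) - 1) = g (Suc x)" if "x < m" for x
  proof -
    have "g (Suc x) \<in> g ` {1..m}" using that by auto
    thus "g (Suc x) - 1 < n" "Suc (g (Suc x) - 1) = g (Suc x)" using im by auto
  qed
  have dim: "dim_row (weight_mat v k) = k" "dim_col (weight_mat v k) = k" for v :: "nat \<Rightarrow> nat \<Rightarrow> 'a" and k
    by (simp_all add: weight_mat_def)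
  have sub: "del (weight_mat w n) I = submatrix (weight_mat w n) S S"
    by (simp add: del_def S_def)
  show ?thesis
  proof (rule eq_matI, unfold dim)
    fix i j assume ij: "i < m" "j < m"
    have "del (weight_mat w n) I $$ (i, j) = weight_mat w n $$ (pick S i, pick S j)"
      unfolding sub by (rule submatrix_index) (simp_all only: dim card ij)
    also have "\<dots> = w (g (Suc i)) (g (Suc j))"
      using lt[OF ij(1)] lt[OF ij(2)] by (simp add: pick ij weight_mat_def)
    also have "\<dots> = weight_mat (\<lambda>i j. w (g i) (g j)) m $$ (i, j)"
      using ij by (simp add: weight_mat_def)
    finally show "del (weight_mat w n) I $$ (i, j) = weight_mat (\<lambda>i j. w (g i) (g j)) m $$ (i, j)" .
  qed (simp_all only: sub dim_submatrix dim card)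
qed

lemma perfect_matchings_empty: "perfect_matchings {} = {{}}"
  unfolding perfect_matchings_def by simp

lemma perfect_matchings_2: "perfect_matchings {1..2} = {{(1, 2)}}"
proof (intro equalityI subsetI)
  fix m assume m: "m \<in> perfect_matchings {1..2}"
  have "p = (1, 2)" if "p \<in> m" for p
    using perfect_matchings_memD[OF m, of "fst p" "snd p"] that by (auto simp: prod_eq_iff)
  moreover have "m \<noteq> {}" using perfect_matchings_ex[OF m, of 1] by auto
  ultimately show "m \<in> {{(1, 2)}}" by blast
next
  fix m :: "(nat \<times> nat) set" assume "m \<in> {{(1, 2)}}"
  hence "m = insert (edge 1 2) {}" by (simp add: edge_def)
  moreover have "{} \<in> perfect_matchings ({1..2} - {1, 2})"
  proof -
    have "{1..2} - {1, 2 :: nat} = {}" by auto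
    thus ?thesis by (simp only: perfect_matchings_empty insert_iff simp_thms)
  qed
  ultimately show "m \<in> perfect_matchings {1..2}"
    by (simp only:) (rule insert_edge_perfect_matching, auto)
qed

text \<open>The non-vanishing assumption ranges over all increasing \<open>f\<close> and all sizes
  to be stable under deletion: composing with \<open>skip p q\<close> or with the shift by 2 gives
  another such relabelling. It therefore passes to the smaller weights in the induction, and the
  shift itself gives the divisor.\<close>

lemma lambda_pf_weight_mat:
  fixes l :: "'a::field"
  assumes l: "l \<noteq> 0"
    and nz: "\<And>f k. strict_mono f \<Longrightarrow> lambda_sum l (\<lambda>i j. w (f i) (f j)) k \<noteq> 0"
  shows "lambda_pf l n (weight_mat w (2 * n)) = lambda_sum l w n"
  using nz
proof (induction n arbitrary: w rule: induct_nat_012)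
  case 0
  show ?case by (simp add: lambda_sum_def perfect_matchings_empty cross_eq_sum nest_eq_sum)
next
  case 1
  have "entry (weight_mat w 2) 1 2 = w 1 2" by (simp add: entry_def weight_mat_def numeral_2_eq_2)
  moreover have "lambda_sum l w 1 = w 1 2"
    by (simp add: lambda_sum_def perfect_matchings_2[simplified] cross_eq_sum nest_eq_sum crossing_def nesting_def)
  ultimately show ?case by simp
next
  case (ge2 k)
  define N where "N = 2 * k + 4"
  let ?w = "\<lambda>p q i j. w (skip p q i) (skip p q j)"
  have N2: "2 * Suc (Suc k) = N" "2 * (k + 2) = N" by (simp_all add: N_def)
  have outer: "lambda_pf l (Suc k) (del (weight_mat w N) {p, q}) = lambda_sum l (?w p q) (Suc k)"
    if "1 \<le> p" "p < q" "q \<le> N" for p q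
  proof -
    have "2 * Suc k + 2 = N" by (simp add: N_def)
    hence "skip p q ` {1..2 * Suc k} = {1..N} - {p, q}"
      using skip_image[of p q "2 * Suc k"] that by (simp only:)
    hence "del (weight_mat w N) {p, q} = weight_mat (?w p q) (2 * Suc k)"
      using that by (intro del_weight_mat strict_mono_skip)
    moreover have "lambda_sum l (\<lambda>i j. ?w p q (f i) (f j)) k' \<noteq> 0" if "strict_mono f" for f k'
      using ge2.prems[of "skip p q \<circ> f" k'] strict_mono_compose[OF strict_mono_skip[OF \<open>p < q\<close>] that]
      by (simp add: o_def)
    ultimately show ?thesis using ge2.IH(2)[of "?w p q"] by simp
  qed
  have inner: "lambda_pf l k (del (weight_mat w N) {1, 2, N - 1, N}) = lambda_sum l (\<lambda>i j. w (i + 2) (j + 2)) k"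
  proof -
    have "(\<lambda>i. i + 2) ` {1..2 * k} = {1..N} - {1, 2, N - 1, N}"
      unfolding N_def image_add_atLeastAtMost' by auto
    hence "del (weight_mat w N) {1, 2, N - 1, N} = weight_mat (\<lambda>i j. w (i + 2) (j + 2)) (2 * k)"
      by (intro del_weight_mat) (auto simp: strict_mono_def)
    moreover have "lambda_sum l (\<lambda>i j. w (f i + 2) (f j + 2)) k' \<noteq> 0" if "strict_mono f" for f k'
      using ge2.prems[of "\<lambda>i. f i + 2" k'] that by (simp add: strict_mono_def)
    ultimately show ?thesis using ge2.IH(1)[of "\<lambda>i j. w (i + 2) (j + 2)"] by simp
  qed
  have Suc: "k + 1 = Suc k" "k + 2 = Suc (Suc k)" by simp_all
  have "lambda_sum l (\<lambda>i j. w (i + 2) (j + 2)) k \<noteq> 0"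
    using ge2.prems[of "\<lambda>i. i + 2" k] by (simp add: strict_mono_def)
  moreover have "1 < N - 1" "2 < N - 1" "N - 1 < N" "2 < N" by (simp_all add: N_def)
  ultimately show ?case
    using lambda_sum_recurrence[OF l N_def, of w, unfolded Suc]
    unfolding lambda_pf.simps Let_def N2
    by (simp add: outer inner field_simps del: One_nat_def)
qed

section \<open>Non-vanishing for the generic matrix\<close>

lemma to_fract_sum: "to_fract (sum f A) = (\<Sum>x\<in>A. to_fract (f x))"
  by (induction A rule: infinite_finite_induct) simp_all

lemma to_fract_prod: "to_fract (prod f A) = (\<Prod>x\<in>A. to_fract (f x))"
  by (induction A rule: infinite_finite_induct) simp_all

lemma to_fract_power: "to_fract (x ^ n) = to_fract x ^ n"
  by (induction n) simp_all

lemma var_eq_to_fract: "var x = to_fract (Poly_Mapping.single (Poly_Mapping.single x 1) 1)"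
  by (simp add: var_def to_fract_def)

lemma single_power: "Poly_Mapping.single (Poly_Mapping.single x 1) 1 ^ n
    = (Poly_Mapping.single (Poly_Mapping.single x n) 1 :: ('b \<Rightarrow>\<^sub>0 nat) \<Rightarrow>\<^sub>0 'a::comm_semiring_1)"
  by (induction n) (simp_all add: mult_single single_add[symmetric])

lemma prod_single: "(\<Prod>x\<in>A. Poly_Mapping.single (f x) 1)
    = (Poly_Mapping.single (\<Sum>x\<in>A. f x) 1 :: ('b \<Rightarrow>\<^sub>0 nat) \<Rightarrow>\<^sub>0 'a::comm_semiring_1)"
  by (induction A rule: infinite_finite_induct) (simp_all add: mult_single)

lemma perfect_matchings_nonempty: "perfect_matchings {1..2 * k} \<noteq> {}"
proof (induction k)
  case (Suc k)
  then obtain m where "m \<in> perfect_matchings {1..2 * k}" by blast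
  moreover have "{1..2 * k} = {1..2 * Suc k} - {2 * k + 1, 2 * k + 2}" by auto
  ultimately have "insert (edge (2 * k + 1) (2 * k + 2)) m \<in> perfect_matchings {1..2 * Suc k}"
    by (intro insert_edge_perfect_matching) auto
  thus ?case by blast
qed (simp add: perfect_matchings_empty)

lemma var_neq_0: "var x \<noteq> (0 :: 'a::field ratfun)"
proof -
  have "Poly_Mapping.lookup (Poly_Mapping.single (Poly_Mapping.single x 1) (1 :: 'a)) (Poly_Mapping.single x 1) \<noteq> 0" by simp
  hence "Poly_Mapping.single (Poly_Mapping.single x 1) (1 :: 'a) \<noteq> 0" by (metis Poly_Mapping.lookup_zero)
  thus ?thesis by (simp add: var_eq_to_fract del: One_nat_def)
qed

text \<open>Distinct matchings contribute distinct monomials, so nothing cancels.\<close>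

lemma lambda_sum_generic_neq_0:
  fixes f :: "nat \<Rightarrow> nat" and w :: "nat \<Rightarrow> nat \<Rightarrow> 'a::field ratfun"
  assumes f: "strict_mono f" and w: "\<And>i j. i < j \<Longrightarrow> w i j = var (Entry i j)"
  shows "lambda_sum (var Lambda) (\<lambda>i j. w (f i) (f j)) k \<noteq> 0"
proof -
  let ?M = "perfect_matchings {1..2 * k}"
  define x :: "nat \<times> nat \<Rightarrow> indet \<Rightarrow>\<^sub>0 nat" where
    "x p = Poly_Mapping.single (Entry (f (fst p)) (f (snd p))) 1" for p
  define mon where "mon m = Poly_Mapping.single Lambda (cross m + nest m) + (\<Sum>p\<in>m. x p)" for m
  \<comment> \<open>The sum comes from the polynomial ring, where one nonzero coefficient is
    enough.\<close>
  define P :: "(indet \<Rightarrow>\<^sub>0 nat) \<Rightarrow>\<^sub>0 'a" where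
    "P = (\<Sum>m\<in>?M. (- 1) ^ cross m * Poly_Mapping.single (mon m) 1)"
  have fin: "finite ?M" by (simp add: finite_perfect_matchings)
  have "lambda_sum (var Lambda) (\<lambda>i j. w (f i) (f j)) k = to_fract P"
    unfolding lambda_sum_def P_def to_fract_sum
  proof (rule sum.cong[OF refl])
    fix m assume m: "m \<in> ?M"
    have "(\<Prod>(i, j)\<in>m. w (f i) (f j)) = (\<Prod>p\<in>m. to_fract (Poly_Mapping.single (x p) 1))"
    proof (rule prod.cong[OF refl], clarify)
      fix i j assume "(i, j) \<in> m"
      hence "f i < f j" using perfect_matchings_memD(3)[OF m] strict_mono_less[OF f] by blast
      thus "w (f i) (f j) = to_fract (Poly_Mapping.single (x (i, j)) 1)"
        by (simp add: w x_def var_eq_to_fract)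
    qed
    also have "\<dots> = to_fract (Poly_Mapping.single (sum x m) 1)"
      by (simp only: to_fract_prod[symmetric] prod_single)
    finally have prod: "(\<Prod>(i, j)\<in>m. w (f i) (f j)) = to_fract (Poly_Mapping.single (sum x m) 1)" .
    have power: "var Lambda ^ n = to_fract (Poly_Mapping.single (Poly_Mapping.single Lambda n) (1 :: 'a))" for n
      by (simp only: var_eq_to_fract to_fract_power[symmetric] single_power)
    have "Poly_Mapping.single (mon m) (1 :: 'a)
        = Poly_Mapping.single (Poly_Mapping.single Lambda (cross m + nest m)) 1 * Poly_Mapping.single (sum x m) 1"
      by (simp add: mon_def mult_single)
    thus "(- 1) ^ cross m * var Lambda ^ (cross m + nest m) * (\<Prod>(i, j)\<in>m. w (f i) (f j))
        = to_fract ((- 1) ^ cross m * Poly_Mapping.single (mon m) 1)"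
      by (simp add: prod power to_fract_power mult.assoc)
  qed
  moreover have "P \<noteq> 0"
  proof -
    \<comment> \<open>As \<open>f\<close> is injective, the \<open>Entry\<close> variables of the
      monomial recover the edges, whatever the power of lambda.\<close>
    have edges: "m = {p. Poly_Mapping.lookup (mon m) (Entry (f (fst p)) (f (snd p))) \<noteq> 0}" if "m \<in> ?M" for m
    proof -
      have m: "finite m" using finite_perfect_matching[OF that] by simp
      have "Poly_Mapping.lookup (mon m) (Entry (f (fst p)) (f (snd p))) = (\<Sum>q\<in>m. if q = p then 1 else 0)" for p
        unfolding mon_def lookup_add lookup_sum x_def
        by (simp add: lookup_single when_def strict_mono_eq[OF f] del: One_nat_def flip: prod_eq_iff)
      thus ?thesis using m by auto
    qed
    hence inj: "m = m'" if "m \<in> ?M" "m' \<in> ?M" "mon m = mon m'" for m m'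
      using that by metis
    \<comment> \<open>Any matching serves: its monomial has coefficient 1 or -1, nonzero in every
      characteristic.\<close>
    obtain m0 where m0: "m0 \<in> ?M" using perfect_matchings_nonempty by blast
    have "(- 1) ^ n * Poly_Mapping.single t (1 :: 'a) = Poly_Mapping.single t ((- 1) ^ n)" for n and t :: "indet \<Rightarrow>\<^sub>0 nat"
      by (cases "even n") (simp_all add: single_uminus)
    hence "Poly_Mapping.lookup P (mon m0) = (\<Sum>m\<in>?M. if m = m0 then (- 1) ^ cross m else 0)"
      unfolding P_def lookup_sum using inj[OF _ m0]
      by (intro sum.cong) (auto simp: lookup_single when_def)
    also have "\<dots> = (- 1) ^ cross m0" using fin m0 by simp
    finally show "P \<noteq> 0" by auto
  qed
  ultimately show ?thesis by simp
qed

theorem theorem1: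
  fixes n :: nat
  shows "lambda_pf (var Lambda) n (generic_skew (2 * n) :: 'a::field ratfun mat) =
    (\<Sum>m\<in>perfect_matchings {1..2 * n}.
       (- 1) ^ cross m * var Lambda ^ (cross m + nest m)
       * (\<Prod>(i, j)\<in>m. entry (generic_skew (2 * n)) i j))"
proof -
  define w :: "nat \<Rightarrow> nat \<Rightarrow> 'a ratfun" where
    "w i j = (if i < j then var (Entry i j) else if j < i then - var (Entry j i) else 0)" for i j
  have mat: "generic_skew (2 * n) = weight_mat w (2 * n)"
    by (intro eq_matI) (auto simp: generic_skew_def weight_mat_def w_def)
  \<comment> \<open>\<open>var_neq_0\<close> permits cancelling the powers of lambda, and
    \<open>lambda_sum_generic_neq_0\<close> permits the divisions in the recurrence.\<close>
  have "lambda_pf (var Lambda) n (weight_mat w (2 * n)) = lambda_sum (var Lambda) w n"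
    by (intro lambda_pf_weight_mat var_neq_0 lambda_sum_generic_neq_0) (simp_all add: w_def)
  also have "\<dots> = (\<Sum>m\<in>perfect_matchings {1..2 * n}.
       (- 1) ^ cross m * var Lambda ^ (cross m + nest m)
       * (\<Prod>(i, j)\<in>m. entry (weight_mat w (2 * n)) i j))"
    unfolding lambda_sum_def
  proof (rule sum.cong[OF refl])
    fix m assume m: "m \<in> perfect_matchings {1..2 * n}"
    have "(\<Prod>(i, j)\<in>m. w i j) = (\<Prod>(i, j)\<in>m. entry (weight_mat w (2 * n)) i j)"
    proof (rule prod.cong[OF refl], clarify)
      fix i j assume "(i, j) \<in> m"
      thus "w i j = entry (weight_mat w (2 * n)) i j"
        using perfect_matchings_memD(1,2)[OF m, of i j] by (auto simp: entry_def weight_mat_def)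
    qed
    thus "(- 1) ^ cross m * var Lambda ^ (cross m + nest m) * (\<Prod>(i, j)\<in>m. w i j)
      = (- 1) ^ cross m * var Lambda ^ (cross m + nest m) * (\<Prod>(i, j)\<in>m. entry (weight_mat w (2 * n)) i j)"
      by simp
  qed
  finally show ?thesis by (simp add: mat)
qed

end
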